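(* Let $(X,\mathscr{A},\mu)$ be a probability measure space with $\mu$ non-atomic. Then to each $r\in[0,1]$ one can associate a set $A_r\in\mathscr{A}$ such that $\mu(A_r)=r$ for every $r\in[0,1]$, and $A_r\subseteq A_s$ whenever $r,s\in[0,1]$ and $r\le s$.
   Context: A set $A\in\mathscr{A}$ is an atom of $\mu$ if $\mu(A)>0$ and for every $B\in\mathscr{A}$ either $\mu(A\cap B)=0$ or $\mu(A\setminus B)=0$. The measure $\mu$ is non-atomic if it has no atoms. *)

theory Defs
  imports "HOL-Probability.Probability"
begin

definition measure_atom :: "'a measure \<Rightarrow> 'a set \<Rightarrow> bool" where
  "measure_atom M A \<longleftrightarrow>
     A \<in> sets M \<and> emeasure M A > 0 \<and>
     (\<forall>B\<in>sets M. emeasure M (A \<inter> B) = 0 \<or> emeasure M (A - B) = 0)"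

definition non_atomic :: "'a measure \<Rightarrow> bool" where
  "non_atomic M \<longleftrightarrow> \<not> (\<exists>A. measure_atom M A)"

end

theory Submission
  imports Defs
begin

text \<open>
  By Zorn's lemma take a maximal family of measurable sets, containing the empty set and the whole
  space, that is linearly ordered by inclusion with no two members of equal measure. For each
  \<open>r\<close> let \<open>U\<close> be the union of the members of measure at most \<open>r\<close> and \<open>V\<close> the intersection of those
  of measure at least \<open>r\<close>. If \<open>\<mu> U < \<mu> V\<close>, then, \<open>V - U\<close> not being an atom, there is a set strictly
  between \<open>U\<close> and \<open>V\<close> in measure, which could be added to the family. Hence \<open>\<mu> U = r\<close>, and
  \<open>A\<^sub>r = U\<close> works.
\<close>

text \<open>This single condition makes the family a chain on which the measure is injective. Without
  injectivity, unions of the family could fail to be measurable.\<close>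

definition measure_chain :: "'a measure \<Rightarrow> 'a set set \<Rightarrow> bool" where
  "measure_chain M C \<longleftrightarrow>
     C \<subseteq> sets M \<and> (\<forall>A\<in>C. \<forall>B\<in>C. measure M A \<le> measure M B \<longrightarrow> A \<subseteq> B)"

lemma measure_chain_subset:
  assumes "measure_chain M C" "D \<subseteq> C"
  shows "measure_chain M D"
  using assms unfolding measure_chain_def by blast

text \<open>The defining condition involves only two sets at a time, and any two members of
  \<open>\<Union>S\<close> already lie together in one element of the chain \<open>S\<close>. This
  supplies the upper bounds for Zorn's lemma.\<close>

lemma measure_chain_Union:
  assumes "subset.chain {C. measure_chain M C} S"
  shows "measure_chain M (\<Union>S)"
  unfolding measure_chain_def
proof (intro conjI ballI impI)
  show "\<Union>S \<subseteq> sets M"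
    using assms unfolding subset.chain_def measure_chain_def by blast
next
  fix A B assume "A \<in> \<Union>S" "B \<in> \<Union>S" and le: "measure M A \<le> measure M B"
  then obtain C D where "C \<in> S" "A \<in> C" "D \<in> S" "B \<in> D"
    by blast
  moreover from this have "C \<subseteq> D \<or> D \<subseteq> C"
    using assms unfolding subset_chain_def by blast
  ultimately obtain E where "E \<in> S" "A \<in> E" "B \<in> E"
    by blast
  then show "A \<subseteq> B"
    using assms le unfolding subset.chain_def measure_chain_def by blast
qed

context finite_measure
begin

text \<open>Although \<open>C\<close> may be uncountable, its members are ordered by their measures,
  which are real numbers. A sequence with measures tending to the supremum is therefore cofinal in
  \<open>C\<close>, or else the supremum is attained, so the union reduces to a countable
  one.\<close>

lemma Union_measure_chain:
  assumes C: "measure_chain M C" and ne: "C \<noteq> {}"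
  shows "\<Union>C \<in> sets M" "measure M (\<Union>C) = (SUP A\<in>C. measure M A)"
proof -
  define s where "s = (SUP A\<in>C. measure M A)"
  have sets: "A \<in> sets M" if "A \<in> C" for A
    using C that unfolding measure_chain_def by blast
  have mono: "A \<subseteq> B" if "A \<in> C" "B \<in> C" "measure M A \<le> measure M B" for A B
    using C that unfolding measure_chain_def by blast
  have bdd: "bdd_above (measure M ` C)"
    by (rule bdd_aboveI2[of _ _ "measure M (space M)"]) (rule bounded_measure)
  have le_s: "measure M A \<le> s" if "A \<in> C" for A
    unfolding s_def using bdd that by (rule cSUP_upper2) simp
  have "\<Union>C \<in> sets M \<and> measure M (\<Union>C) = s"
  \<comment> \<open>If \<open>s\<close> is attained, the member attaining it contains all others.
    Otherwise all members are strictly below \<open>s\<close> in measure, which the construction of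
    the sequence relies on.\<close>
  proof (cases "\<exists>A\<in>C. measure M A = s")
    case True
    then obtain A where A: "A \<in> C" "measure M A = s"
      by blast
    then have "\<Union>C = A"
      using mono le_s by blast
    then show ?thesis
      using A sets by simp
  next
    case False
    then have less_s: "measure M A < s" if "A \<in> C" for A
      using le_s that by force
    have near: "\<exists>A\<in>C. t < measure M A" if "t < s" for t
      using that less_cSUP_iff[OF ne bdd] unfolding s_def by blast
    let ?P = "\<lambda>n A. A \<in> C \<and> s - 1 / real (Suc n) < measure M A"
    have "\<exists>F. \<forall>n. ?P n (F n) \<and> F n \<subseteq> F (Suc n)"
    proof (rule dependent_nat_choice)
      show "\<exists>A. ?P 0 A"
        using near[of "s - 1 / real (Suc 0)"] by auto
    next
      fix A n assume A: "?P n A"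
      \<comment> \<open>Exceeding this maximum makes the next set both close enough to
        \<open>s\<close> and larger in measure than \<open>A\<close>, hence a superset of
        \<open>A\<close>.\<close>
      have "max (measure M A) (s - 1 / real (Suc (Suc n))) < s"
        using less_s A by auto
      from near[OF this] obtain B where
        "B \<in> C" "measure M A < measure M B" "s - 1 / real (Suc (Suc n)) < measure M B"
        by auto
      then show "\<exists>B. ?P (Suc n) B \<and> A \<subseteq> B"
        using A mono[of A B] by auto
    qed
    then obtain F where F: "\<And>n. F n \<in> C" "\<And>n. s - 1 / real (Suc n) < measure M (F n)"
      and "incseq F"
      unfolding incseq_Suc_iff by blast
    have "D \<subseteq> (\<Union>n. F n)" if "D \<in> C" for D
    proof -
      have "0 < s - measure M D"
        using less_s that by simp
      then obtain n where "1 / real (Suc n) < s - measure M D"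
        by (rule nat_approx_posE)
      then have "measure M D \<le> measure M (F n)"
        using F(2)[of n] by linarith
      then show ?thesis
        using mono that F(1) by blast
    qed
    then have eq: "\<Union>C = (\<Union>n. F n)"
      using F(1) by blast
    have "(\<lambda>n. measure M (F n)) \<longlonglongrightarrow> measure M (\<Union>n. F n)"
      using F(1) sets \<open>incseq F\<close> by (intro finite_Lim_measure_incseq) auto
    moreover have "(\<lambda>n. measure M (F n)) \<longlonglongrightarrow> s"
    proof (rule real_tendsto_sandwich)
      show "\<forall>\<^sub>F n in sequentially. s - 1 / real (Suc n) \<le> measure M (F n)"
        using F(2) by (intro always_eventually allI less_imp_le)
      show "\<forall>\<^sub>F n in sequentially. measure M (F n) \<le> s"
        by (intro always_eventually allI le_s F(1))
      show "(\<lambda>n. s - 1 / real (Suc n)) \<longlonglongrightarrow> s"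
        using tendsto_diff[OF tendsto_const LIMSEQ_inverse_real_of_nat, of s]
        by (simp add: inverse_eq_divide)
    qed simp
    ultimately have "measure M (\<Union>n. F n) = s"
      by (rule LIMSEQ_unique)
    then show ?thesis
      using eq F(1) sets by auto
  qed
  then show "\<Union>C \<in> sets M" "measure M (\<Union>C) = (SUP A\<in>C. measure M A)"
    unfolding s_def by auto
qed

lemma measure_Union_measure_chain_le:
  assumes "measure_chain M C" "C \<noteq> {}" "\<And>A. A \<in> C \<Longrightarrow> measure M A \<le> r"
  shows "measure M (\<Union>C) \<le> r"
  using assms Union_measure_chain(2) by (simp add: cSUP_least)

text \<open>Complementation reverses both inclusion and the order of the measures, so results on
  unions carry over to intersections.\<close>

lemma measure_chain_Compl:
  assumes "measure_chain M C"
  shows "measure_chain M ((\<lambda>A. space M - A) ` C)"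
  using assms unfolding measure_chain_def
  by (auto simp: finite_measure_compl subset_iff)

lemma Inter_measure_chain:
  assumes C: "measure_chain M C" and ne: "C \<noteq> {}" and ge: "\<And>A. A \<in> C \<Longrightarrow> r \<le> measure M A"
  shows "\<Inter>C \<in> sets M" "r \<le> measure M (\<Inter>C)"
proof -
  let ?U = "\<Union>((\<lambda>A. space M - A) ` C)"
  have sub: "C \<subseteq> sets M"
    using C unfolding measure_chain_def by blast
  have eq: "\<Inter>C = space M - ?U"
  \<comment> \<open>A member of \<open>C\<close> is needed here, since \<open>\<Inter>{}\<close>
    would be the whole type rather than a subset of \<open>space M\<close>.\<close>
  proof -
    obtain A where "A \<in> C"
      using ne by blast
    then have "\<Inter>C \<subseteq> space M"
      using sub sets.sets_into_space[of A M] by blast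
    then show ?thesis
      by blast
  qed
  have U: "?U \<in> sets M"
    using measure_chain_Compl[OF C] ne by (intro Union_measure_chain) auto
  have "measure M ?U \<le> measure M (space M) - r"
  proof (rule measure_Union_measure_chain_le[OF measure_chain_Compl[OF C]])
    fix B assume "B \<in> (\<lambda>A. space M - A) ` C"
    then obtain A where "A \<in> C" "B = space M - A"
      by blast
    then show "measure M B \<le> measure M (space M) - r"
      using ge[of A] sub finite_measure_compl[of A] by auto
  qed (use ne in simp)
  then show "\<Inter>C \<in> sets M" "r \<le> measure M (\<Inter>C)"
    unfolding eq using U finite_measure_compl[OF U] by (blast, linarith)
qed

text \<open>As \<open>A\<close> is not an atom, some \<open>B\<close> cuts it into
  \<open>A \<inter> B\<close> and \<open>A - B\<close>, both of positive measure; the first piece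
  serves as \<open>E\<close>.\<close>

lemma non_atomic_split:
  assumes "non_atomic M" "A \<in> sets M" "0 < measure M A"
  obtains E where "E \<in> sets M" "E \<subseteq> A" "0 < measure M E" "measure M E < measure M A"
proof -
  have "\<not> measure_atom M A" "0 < emeasure M A"
    using assms by (auto simp: non_atomic_def emeasure_eq_measure)
  then obtain B where B: "B \<in> sets M" "emeasure M (A \<inter> B) \<noteq> 0" "emeasure M (A - B) \<noteq> 0"
    using assms(2) unfolding measure_atom_def by blast
  then have "0 < measure M (A \<inter> B)" "0 < measure M (A - B)"
    by (auto simp: emeasure_eq_measure zero_less_measure_iff)
  moreover have "measure M (A - B) = measure M A - measure M (A \<inter> B)"
    using finite_measure_Diff'[OF assms(2) B(1)] .
  ultimately show thesis
    using that[of "A \<inter> B"] B(1) assms(2) by auto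
qed

text \<open>Zorn's lemma is applied to the chains containing \<open>{}\<close> and
  \<open>space M\<close>. Positive total measure separates these two sets in measure, so that
  together they form a chain to start from.\<close>

lemma ex_maximal_measure_chain:
  assumes "0 < measure M (space M)"
  obtains C where "measure_chain M C" "{} \<in> C" "space M \<in> C"
    "\<And>W. measure_chain M (insert W C) \<Longrightarrow> W \<in> C"
proof -
  let ?\<A> = "{C. measure_chain M C \<and> {{}, space M} \<subseteq> C}"
  have "\<exists>C\<in>?\<A>. \<forall>D\<in>?\<A>. C \<subseteq> D \<longrightarrow> D = C"
  proof (rule subset_Zorn_nonempty)
    have "measure_chain M {{}, space M}"
      using assms by (auto simp: measure_chain_def)
    then show "?\<A> \<noteq> {}"
      by blast
  next
    fix S assume S: "S \<noteq> {}" "subset.chain ?\<A> S"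
    then have "subset.chain {C. measure_chain M C} S"
      unfolding subset_chain_def by blast
    then have "measure_chain M (\<Union>S)"
      by (rule measure_chain_Union)
    then show "\<Union>S \<in> ?\<A>"
      using S unfolding subset_chain_def by blast
  qed
  then obtain C where C: "C \<in> ?\<A>" and max: "\<forall>D\<in>?\<A>. C \<subseteq> D \<longrightarrow> D = C"
    by (rule bexE)
  show thesis
  proof (rule that)
    fix W assume "measure_chain M (insert W C)"
    then have "insert W C = C"
      using C by (intro max[rule_format]) auto
    then show "W \<in> C"
      by blast
  qed (use C in auto)
qed

lemma measure_Union_maximal_measure_chain:
  assumes na: "non_atomic M"
    and C: "measure_chain M C" "{} \<in> C" "space M \<in> C"
    and max: "\<And>W. measure_chain M (insert W C) \<Longrightarrow> W \<in> C"
    and r: "0 \<le> r" "r \<le> measure M (space M)"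
  defines "L \<equiv> {D \<in> C. measure M D \<le> r}"
  shows "\<Union>L \<in> sets M" "measure M (\<Union>L) = r"
proof -
  define H where "H = {D \<in> C. r \<le> measure M D}"
  define U where "U = \<Union>L"
  define V where "V = \<Inter>H"
  \<comment> \<open>The bounds on \<open>r\<close> put \<open>{}\<close> into \<open>L\<close> and
    \<open>space M\<close> into \<open>H\<close>.\<close>
  have L: "measure_chain M L" "L \<noteq> {}" and H: "measure_chain M H" "H \<noteq> {}"
    using measure_chain_subset[OF C(1)] C(2,3) r by (auto simp: L_def H_def)
  have U: "U \<in> sets M" "measure M U \<le> r"
    using Union_measure_chain(1)[OF L] measure_Union_measure_chain_le[OF L]
    by (auto simp: U_def L_def)
  have V: "V \<in> sets M" "r \<le> measure M V"
    using Inter_measure_chain[OF H] by (auto simp: V_def H_def)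
  have "U \<subseteq> V"
  proof -
    have "D \<subseteq> E" if "D \<in> L" "E \<in> H" for D E
      using that C(1) unfolding L_def H_def measure_chain_def by force
    then show ?thesis
      unfolding U_def V_def by blast
  qed
  have "\<not> measure M U < measure M V"
  proof
    assume "measure M U < measure M V"
    then have pos: "0 < measure M (V - U)"
      using finite_measure_Diff[OF V(1) U(1) \<open>U \<subseteq> V\<close>] by simp
    obtain E where E: "E \<in> sets M" "E \<subseteq> V - U" "0 < measure M E"
      "measure M E < measure M (V - U)"
      using non_atomic_split[OF na sets.Diff[OF V(1) U(1)] pos] .
    define W where "W = U \<union> E"
    have "measure M W = measure M U + measure M E"
      unfolding W_def using E U(1) by (intro finite_measure_Union) auto
    then have W: "W \<in> sets M" "U \<subseteq> W" "W \<subseteq> V" "measure M U < measure M W"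
      "measure M W < measure M V"
      using E U(1) \<open>U \<subseteq> V\<close> finite_measure_Diff[OF V(1) U(1) \<open>U \<subseteq> V\<close>]
      by (auto simp: W_def)
    \<comment> \<open>The strict inequalities here and in \<open>above\<close> serve twice: they
      exclude ties when \<open>W\<close> is inserted, and they show that \<open>W\<close> cannot
      already belong to \<open>C\<close>.\<close>
    have below: "D \<subseteq> W \<and> measure M D < measure M W" if "D \<in> L" for D
    proof -
      have "D \<subseteq> U"
        using that unfolding U_def by blast
      then show ?thesis
        using finite_measure_mono[OF \<open>D \<subseteq> U\<close> U(1)] W(2,4) by auto
    qed
    have above: "W \<subseteq> D \<and> measure M W < measure M D" if "D \<in> H" for D
    proof -
      have "V \<subseteq> D" "D \<in> sets M"
        using that C(1) unfolding V_def H_def measure_chain_def by auto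
      then show ?thesis
        using finite_measure_mono[of V D] W(3,5) by auto
    qed
    have split: "D \<in> L \<or> D \<in> H" if "D \<in> C" for D
      using that by (auto simp: L_def H_def)
    have "measure_chain M (insert W C)"
      unfolding measure_chain_def
    proof (intro conjI ballI impI)
      show "insert W C \<subseteq> sets M"
        using W(1) C(1) by (auto simp: measure_chain_def)
    next
      fix A B assume AB: "A \<in> insert W C" "B \<in> insert W C" "measure M A \<le> measure M B"
      have C_sub: "A \<subseteq> B" if "A \<in> C" "B \<in> C"
        using C(1) AB(3) that unfolding measure_chain_def by blast
      have "A \<subseteq> B" if "A = W" "B \<in> C"
        using split[OF that(2)] below[of B] above[of B] AB(3) that(1) by auto
      moreover have "A \<subseteq> B" if "B = W" "A \<in> C"
        using split[OF that(2)] below[of A] above[of A] AB(3) that(1) by auto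
      ultimately show "A \<subseteq> B"
        using AB(1,2) C_sub by blast
    qed
    then have "W \<in> C"
      by (rule max)
    then show False
      using below above split by blast
  qed
  \<comment> \<open>The values are squeezed:
    \<open>measure M U \<le> r \<le> measure M V \<le> measure M U\<close>.\<close>
  then show "\<Union>L \<in> sets M" "measure M (\<Union>L) = r"
    using U V unfolding U_def by auto
qed

end

theorem theorem2p3:
  fixes M :: "'a measure"
  assumes "prob_space M"
    and "non_atomic M"
  shows "\<exists>A :: real \<Rightarrow> 'a set.
           (\<forall>r\<in>{0..1}. A r \<in> sets M \<and> measure M (A r) = r) \<and>
           (\<forall>r\<in>{0..1}. \<forall>s\<in>{0..1}. r \<le> s \<longrightarrow> A r \<subseteq> A s)"
proof -
  interpret prob_space M by fact
  obtain C where C: "measure_chain M C" "{} \<in> C" "space M \<in> C"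
    "\<And>W. measure_chain M (insert W C) \<Longrightarrow> W \<in> C"
    using ex_maximal_measure_chain by (auto simp: prob_space)
  let ?A = "\<lambda>r. \<Union>{D \<in> C. measure M D \<le> r}"
  have "\<forall>r\<in>{0..1}. ?A r \<in> sets M \<and> measure M (?A r) = r"
    using measure_Union_maximal_measure_chain[OF assms(2) C] by (auto simp: prob_space)
  moreover have "\<forall>r\<in>{0..1}. \<forall>s\<in>{0..1}. r \<le> s \<longrightarrow> ?A r \<subseteq> ?A s"
    by force
  ultimately show ?thesis
    by (intro exI[of _ ?A] conjI)
qed

end
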